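(* Let $d \geqslant 1$, let $A \subset \mathbb{Z}^d$ be a nonempty finite set, and let $a_0 \in A$. Then for all positive integers $N \geqslant (d\,|A|\cdot w(A))^{13 d^6}$ one has $$NA = \bigl(N H(A) \cap (a_0 N + \Lambda_{A-A})\bigr) \setminus \Bigl(\bigcup_{a \in \operatorname{ex}(H(A))} \bigl(aN - \mathcal{E}(a-A)\bigr)\Bigr).$$
   Context: For a positive integer $N$, $NA := \{a_1 + \cdots + a_N : a_i \in A\}$. $w(A) := \max_{a_1,a_2\in A}\|a_1-a_2\|_\infty$. $H(A)$ is the convex hull of $A$ in $\mathbb{R}^d$, and $NH(A) = \{Nx : x \in H(A)\}$. $\operatorname{ex}(H(A))$ is the set of extremal points of $H(A)$: those $p \in H(A)$ for which there are a vector $v \in \operatorname{span}(A-A)\setminus\{0\}$ and a constant $c$ with $\langle v,p\rangle = c$ and $\langle v,x\rangle > c$ for all $x \in H(A)\setminus\{p\}$; it is a subset of $A$. Here $A - A = \{a-a' : a,a' \in A\}$ and $a - A = \{a - a' : a' \in A\}$. For a finite set $S \subset \mathbb{Z}^d$, $\Lambda_S$ is the subgroup of $\mathbb{Z}^d$ generated by $S$. For a finite set $S \subset \mathbb{Z}^d$ with $0 \in S$: $C_S := \{\sum_{s\in S} c_s s : c_s \in \mathbb{R}_{\geqslant 0}\}$, $\mathcal{P}(S) := \bigcup_{N\geqslant 1} NS$, and the set of exceptional elements is $\mathcal{E}(S) := (C_S \cap \Lambda_S)\setminus \mathcal{P}(S)$. Also $aN - \mathcal{E}(a-A) = \{aN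 - e : e \in \mathcal{E}(a-A)\}$. *)

theory Defs
  imports "HOL-Analysis.Analysis" "HOL-Computational_Algebra.Group_Closure"
begin

text \<open>
  The lattice $\mathbb{Z}^d$ is taken inside $\mathbb{R}^d$, so that sumsets, convex hulls and cones
  all live in one type. On sets, \<open>A - B\<close> is set-theoretic difference, so the Minkowski difference
  gets its own constant.
\<close>

definition int_lattice :: "(real ^ 'n) set" where
  "int_lattice = {x. \<forall>i. x $ i \<in> \<int>}"

definition sumset :: "nat \<Rightarrow> (real ^ 'n) set \<Rightarrow> (real ^ 'n) set" where
  "sumset N A = {(\<Sum>i<N. a i) | a. \<forall>i<N. a i \<in> A}"

definition diffset :: "(real ^ 'n) set \<Rightarrow> (real ^ 'n) set \<Rightarrow> (real ^ 'n) set" where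
  "diffset A B = {a - b | a b. a \<in> A \<and> b \<in> B}"

text \<open>Only meaningful for finite nonempty \<open>A\<close>.\<close>

definition width :: "(real ^ 'n) set \<Rightarrow> real" where
  "width A = Max {infnorm (a1 - a2) | a1 a2. a1 \<in> A \<and> a2 \<in> A}"

text \<open>
  The normal \<open>v\<close> is a nonzero vector of the span of \<open>A - A\<close>; hence a
  one-point set has no extremal points in this sense, unlike with \<open>extreme_point_of\<close>.
\<close>

definition extremal_points :: "(real ^ 'n) set \<Rightarrow> (real ^ 'n) set" where
  "extremal_points A = {p \<in> convex hull A.
     \<exists>v \<in> span (diffset A A) - {0}. \<exists>c. v \<bullet> p = c \<and> (\<forall>x \<in> convex hull A - {p}. v \<bullet> x > c)}"

text \<open>The next three are used for finite \<open>S\<close> containing \<open>0\<close>.\<close>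

definition gen_cone :: "(real ^ 'n) set \<Rightarrow> (real ^ 'n) set" where
  "gen_cone S = {(\<Sum>s\<in>S. c s *\<^sub>R s) | c. \<forall>s\<in>S. c s \<ge> 0}"

definition all_sums :: "(real ^ 'n) set \<Rightarrow> (real ^ 'n) set" where
  "all_sums S = (\<Union>N\<in>{1..}. sumset N S)"

definition exceptional :: "(real ^ 'n) set \<Rightarrow> (real ^ 'n) set" where
  "exceptional S = (gen_cone S \<inter> group_closure S) - all_sums S"

end

theory Submission
  imports Defs
begin

text \<open>
  That \<open>N A\<close> lies in the right-hand side is immediate. For the converse let \<open>x = N h\<close> with \<open>h\<close> in the
  convex hull of \<open>A\<close> and \<open>x - N a0\<close> in the group generated by \<open>A - A\<close>. Then \<open>N a - x\<close> lies in the cone and in the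
  group generated by \<open>a - A\<close>. If \<open>x\<close> avoids all the sets \<open>a N - E(a - A)\<close>, then for each extremal point \<open>a\<close> the vector \<open>N a - x\<close> is a sum of elements of \<open>a - A\<close>,
  with no control on the number of terms. If it can be written with at most \<open>N\<close> terms for one
  single \<open>a\<close>, then padding with copies of \<open>a\<close> puts \<open>x\<close> into \<open>N A\<close>. The point to use is found by
  writing \<open>h\<close> as a convex combination of extreme points: one of them, \<open>a\<close>, has weight at
  least \<open>1 / |A|\<close> (\<open>extreme_point_of_large_weight\<close>). Then
  \<open>N a - x = (\<Sum>b\<in>A. l b *\<^sub>R (a - b))\<close> with real coefficients \<open>l b \<ge> 0\<close> whose sum over
  \<open>b \<noteq> a\<close> is at most \<open>N - N / |A|\<close>.

  So \<open>N a - x\<close> has two representations: one with natural coefficients \<open>n b\<close>, perhaps very large,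
  and one with real coefficients \<open>l b\<close> of small total. Together they form a nonnegative real
  relation among the integer vectors \<open>a - b\<close> (coefficients \<open>n b\<close>) and \<open>b - a\<close> (coefficients \<open>l b\<close>).
  A nonnegative relation is a nonnegative combination of relations of minimal support, and by
  Cramer's rule those can be taken integral with entries at most \<open>D = d! w ^ d\<close>
  (\<open>obtain_small_integer_relation\<close>). Rounding down the coefficients of this combination gives an
  integer relation that differs from the real one by at most \<open>2 |A| D\<close> in each place
  (\<open>round_down_nonneg_relation\<close>). Subtracting it from the \<open>n\<close>-side and adding it on the \<open>l\<close>-side leaves a
  representation of \<open>N a - x\<close> with natural coefficients that are at most \<open>l b + 2 |A| D\<close>
  (\<open>exchange_sums_with_few_extra_terms\<close>). Its number of terms is at most
  \<open>N - N / |A| + 2 |A|\<^sup>2 D\<close>, hence at most \<open>N\<close> as soon as \<open>N \<ge> 2 |A| ^ 3 d! w ^ d\<close>, and the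
  threshold \<open>(d |A| w) ^ (13 d ^ 6)\<close> is at least this large whenever \<open>A\<close> has at least two points.
\<close>

section \<open>Coordinates of integer vectors\<close>

lemma det_in_Ints:
  fixes M :: "real ^ 'n ^ 'n"
  assumes "\<And>i j. M $ i $ j \<in> \<int>"
  shows "det M \<in> \<int>"
  unfolding det_def by (intro Ints_sum Ints_mult Ints_prod Ints_of_int assms)

lemma abs_det_le:
  fixes M :: "real ^ 'n ^ 'n"
  assumes W: "\<And>i j. \<bar>M $ i $ j\<bar> \<le> W"
  shows "\<bar>det M\<bar> \<le> fact CARD('n) * W ^ CARD('n)"
proof -
  let ?P = "{p. p permutes (UNIV :: 'n set)}"
  have "\<bar>det M\<bar> \<le> (\<Sum>p\<in>?P. \<bar>of_int (sign p) * (\<Prod>i\<in>UNIV. M $ i $ p i)\<bar>)"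
    unfolding det_def by (rule sum_abs)
  also have "\<dots> \<le> (\<Sum>p\<in>?P. W ^ CARD('n))"
  proof (rule sum_mono)
    fix p assume "p \<in> ?P"
    have "\<bar>of_int (sign p) * (\<Prod>i\<in>UNIV. M $ i $ p i)\<bar> = (\<Prod>i\<in>UNIV. \<bar>M $ i $ p i\<bar>)"
      by (simp add: abs_mult sign_def abs_prod)
    also have "\<dots> \<le> (\<Prod>i\<in>(UNIV::'n set). W)"
      by (rule prod_mono) (simp add: W)
    finally show "\<bar>of_int (sign p) * (\<Prod>i\<in>UNIV. M $ i $ p i)\<bar> \<le> W ^ CARD('n)"
      by simp
  qed
  also have "\<dots> = fact CARD('n) * W ^ CARD('n)"
    by (simp add: card_permutations[OF refl])
  finally show ?thesis .
qed

text \<open>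
  Complete \<open>T\<close> to a basis of the whole space by standard basis vectors, whose entries are integers
  bounded by \<open>W\<close> as well because \<open>W \<ge> 1\<close>, so that Cramer's rule applies to a square matrix. Its
  determinant is up to sign the common denominator \<open>D\<close>, and each \<open>D z\<close> is up to sign the determinant
  with one column replaced by the given combination.
\<close>

lemma bounded_denominator_of_coordinates:
  fixes T :: "(real ^ 'n) set" and W :: real
  assumes ind: "independent T" and W1: "W \<ge> 1"
    and TZ: "T \<subseteq> int_lattice" and TW: "\<And>t i. t \<in> T \<Longrightarrow> \<bar>t $ i\<bar> \<le> W"
    and cZ: "(\<Sum>t\<in>T. z t *\<^sub>R t) \<in> int_lattice" and cW: "\<And>i. \<bar>(\<Sum>t\<in>T. z t *\<^sub>R t) $ i\<bar> \<le> W"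
  obtains D :: real where "D \<in> \<int>" "0 < D" "D \<le> fact CARD('n) * W ^ CARD('n)"
    "\<And>t. t \<in> T \<Longrightarrow> D * z t \<in> \<int> \<and> \<bar>D * z t\<bar> \<le> fact CARD('n) * W ^ CARD('n)"
proof -
  define c where "c = (\<Sum>t\<in>T. z t *\<^sub>R t)"
  obtain B where B: "T \<subseteq> B" "B \<subseteq> T \<union> Basis" "independent B" "T \<union> Basis \<subseteq> span B"
    using maximal_independent_subset_extend[of T "T \<union> Basis"] ind by auto
  have "span B = UNIV"
    using B(4) span_Basis by (metis Un_subset_iff span_mono span_span top.extremum_uniqueI)
  then have "card B = DIM(real ^ 'n)"
    using B(3) by (metis dim_UNIV dim_eq_card_independent dim_span)
  then have cB: "card B = CARD('n)" by simp
  have finB: "finite B" using B(3) by (rule independent_imp_finite)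
  then obtain f :: "'n \<Rightarrow> real ^ 'n" where f: "bij_betw f UNIV B"
    using finite_same_card_bij[of "UNIV :: 'n set" B] cB by auto
  have fB: "f j \<in> B" for j using f by (auto simp: bij_betw_def)
  have axis: "\<bar>b $ i\<bar> \<le> W \<and> b $ i \<in> \<int>" if "b \<in> Basis" for b :: "real ^ 'n" and i
    using that W1 by (auto simp: Basis_vec_def axis_def)
  have BW: "\<bar>b $ i\<bar> \<le> W \<and> b $ i \<in> \<int>" if "b \<in> B" for b i
    using that B(2) axis[of b i] TW[of b i] TZ by (auto simp: int_lattice_def)
  define M :: "real ^ 'n ^ 'n" where "M = (\<chi> i j. f j $ i)"
  have col: "column j M = f j" for j by (simp add: M_def column_def vec_eq_iff)
  have "\<exists>L. L ** M = mat 1"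
    unfolding matrix_left_invertible_independent_columns
  proof (intro allI impI)
    fix u :: "'n \<Rightarrow> real" and j
    assume "(\<Sum>i\<in>UNIV. u i *s column i M) = 0"
    then have "(\<Sum>i\<in>UNIV. u i *\<^sub>R f i) = 0" by (simp add: col scalar_mult_eq_scaleR)
    moreover have "(\<Sum>b\<in>B. u (inv f b) *\<^sub>R b) = (\<Sum>i\<in>UNIV. u (inv f (f i)) *\<^sub>R f i)"
      by (rule sum.reindex_bij_betw[OF f, symmetric])
    ultimately have "(\<Sum>b\<in>B. u (inv f b) *\<^sub>R b) = 0"
      using f by (simp add: bij_betw_def)
    then have "u (inv f (f j)) = 0"
      using independentD[OF B(3) finB subset_refl _ fB[of j], of "\<lambda>b. u (inv f b)"] by simp
    then show "u j = 0" using f by (simp add: bij_betw_def)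
  qed
  then have det0: "det M \<noteq> 0"
    by (metis invertible_det_nz invertible_left_inverse)
  define x :: "real ^ 'n" where "x = (\<chi> j. if f j \<in> T then z (f j) else 0)"
  have "M *v x = (\<Sum>j\<in>UNIV. (if f j \<in> T then z (f j) else 0) *\<^sub>R f j)"
    by (simp add: matrix_mult_sum col x_def scalar_mult_eq_scaleR)
  also have "\<dots> = (\<Sum>b\<in>B. (if b \<in> T then z b else 0) *\<^sub>R b)"
    by (rule sum.reindex_bij_betw[OF f])
  also have "\<dots> = c"
    unfolding c_def using B(1) finB by (intro sum.mono_neutral_cong_right) auto
  finally have Mx: "M *v x = c" .
  have cof: "x $ k * det M \<in> \<int> \<and> \<bar>x $ k * det M\<bar> \<le> fact CARD('n) * W ^ CARD('n)" for k
    unfolding cramer_lemma[of k M x, symmetric] Mx using BW[OF fB] cZ cW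
    by (intro conjI det_in_Ints abs_det_le) (auto simp: M_def c_def int_lattice_def)
  show ?thesis
  proof
    show "\<bar>det M\<bar> \<in> \<int>" "\<bar>det M\<bar> \<le> fact CARD('n) * W ^ CARD('n)"
      using BW[OF fB] by (auto intro!: Ints_abs det_in_Ints abs_det_le simp: M_def)
    show "0 < \<bar>det M\<bar>" using det0 by simp
    fix t assume t: "t \<in> T"
    then obtain k where k: "t = f k" using B(1) f by (auto simp: bij_betw_def)
    then have "x $ k = z t" using t by (simp add: x_def)
    then have "\<bar>det M\<bar> * z t = x $ k * det M \<or> \<bar>det M\<bar> * z t = - (x $ k * det M)"
      by (auto simp: abs_if)
    then show "\<bar>det M\<bar> * z t \<in> \<int> \<and> \<bar>\<bar>det M\<bar> * z t\<bar> \<le> fact CARD('n) * W ^ CARD('n)"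
      using cof[of k] by (metis Ints_minus abs_minus_cancel)
  qed
qed

section \<open>Nonnegative relations between integer vectors\<close>

text \<open>
  Among the nonnegative relations supported inside the support of \<open>u\<close>, one of minimal support is
  unique up to scaling; otherwise subtracting a multiple of a second one would empty a place of the
  support. So any one of its vectors depends on the remaining ones, which are independent, and the
  coordinates have a small common denominator.
\<close>

lemma obtain_small_integer_relation:
  fixes c :: "'i \<Rightarrow> real ^ 'n" and u :: "'i \<Rightarrow> real"
  assumes fin: "finite I" and W1: "W \<ge> 1"
    and cZ: "\<And>i. i \<in> I \<Longrightarrow> c i \<in> int_lattice"
    and cW: "\<And>i k. i \<in> I \<Longrightarrow> \<bar>c i $ k\<bar> \<le> W"
    and u0: "\<And>i. i \<in> I \<Longrightarrow> u i \<ge> 0" and rel: "(\<Sum>i\<in>I. u i *\<^sub>R c i) = 0"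
    and pos: "i0 \<in> I" "u i0 > 0"
  obtains r :: "'i \<Rightarrow> nat" where "\<exists>i\<in>I. r i > 0"
    "\<And>i. i \<in> I \<Longrightarrow> u i = 0 \<Longrightarrow> r i = 0"
    "\<And>i. i \<in> I \<Longrightarrow> real (r i) \<le> fact CARD('n) * W ^ CARD('n)"
    "(\<Sum>i\<in>I. real (r i) *\<^sub>R c i) = 0"
proof -
  define Q where "Q S \<longleftrightarrow> S \<subseteq> I \<and> S \<noteq> {} \<and>
    (\<exists>y. (\<forall>i\<in>S. y i > 0) \<and> (\<Sum>i\<in>S. y i *\<^sub>R c i) = (0::real^'n))" for S
  define S0 where "S0 = {i\<in>I. u i > 0}"
  have "(\<Sum>i\<in>S0. u i *\<^sub>R c i) = (\<Sum>i\<in>I. u i *\<^sub>R c i)"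
    using fin u0 unfolding S0_def by (intro sum.mono_neutral_left) (auto simp: less_le)
  then have "Q S0" unfolding Q_def using rel pos by (auto simp: S0_def intro!: exI[of _ u])
  define S where "S = (ARG_MIN card S. Q S \<and> S \<subseteq> S0)"
  have "Q S \<and> S \<subseteq> S0"
    unfolding S_def by (rule arg_min_natI[of _ S0]) (use \<open>Q S0\<close> in auto)
  then have QS: "Q S" and SS0: "S \<subseteq> S0" by auto
  have Smin: "card S \<le> card S'" if "Q S'" "S' \<subseteq> S" for S'
    unfolding S_def using that SS0 by (intro arg_min_nat_le) auto
  from QS obtain y where SI: "S \<subseteq> I" "S \<noteq> {}" and y0: "\<And>i. i \<in> S \<Longrightarrow> y i > 0"
    and yrel: "(\<Sum>i\<in>S. y i *\<^sub>R c i) = 0" unfolding Q_def by auto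
  have finS: "finite S" using SI fin finite_subset by blast
  \<comment> \<open>If \<open>y - t v\<close> is nonnegative with the largest possible \<open>t\<close>, it vanishes somewhere in \<open>S\<close>, so
    by minimality of \<open>S\<close> it is zero.\<close>
  have proportional: "\<exists>t. \<forall>i\<in>S. y i = t * v i"
    if vrel: "(\<Sum>i\<in>S. v i *\<^sub>R c i) = 0" and ex: "\<exists>i\<in>S. v i > 0" for v
  proof -
    define P where "P = {i\<in>S. v i > 0}"
    have P: "finite P" "P \<noteq> {}" using finS ex by (auto simp: P_def)
    define k where "k = arg_min_on (\<lambda>i. y i / v i) P"
    have kP: "k \<in> P" unfolding k_def using P by (rule arg_min_if_finite)
    have kmin: "y k / v k \<le> y i / v i" if "i \<in> P" for i
      unfolding k_def using arg_min_least[OF P(1) P(2) that] .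
    define t where "t = y k / v k"
    have t0: "t > 0" using kP y0 by (auto simp: t_def P_def)
    define w where "w i = y i - t * v i" for i
    have w0: "w i \<ge> 0" if "i \<in> S" for i
    proof (cases "v i > 0")
      case True
      then show ?thesis using kmin[of i] that by (simp add: P_def w_def t_def[symmetric] field_simps)
    next
      case False
      then have "t * v i \<le> 0" using t0 by (simp add: mult_nonneg_nonpos)
      then show ?thesis using y0[OF that] by (simp add: w_def)
    qed
    have wk: "w k = 0" using kP by (simp add: w_def t_def P_def)
    have wrel: "(\<Sum>i\<in>S. w i *\<^sub>R c i) = 0"
      using yrel vrel by (simp add: w_def scaleR_diff_left sum_subtractf
          flip: scaleR_scaleR scaleR_sum_right)
    have "w i = 0" if i: "i \<in> S" for i
    proof (rule ccontr)
      assume "w i \<noteq> 0"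
      define S' where "S' = {i\<in>S. w i > 0}"
      have "S' \<noteq> {}" using \<open>w i \<noteq> 0\<close> i w0[OF i] by (auto simp: S'_def)
      have "(\<Sum>i\<in>S'. w i *\<^sub>R c i) = (\<Sum>i\<in>S. w i *\<^sub>R c i)"
        using finS w0 unfolding S'_def by (intro sum.mono_neutral_left) (auto simp: less_le)
      then have "Q S'" unfolding Q_def using wrel SI \<open>S' \<noteq> {}\<close>
        by (auto simp: S'_def intro!: exI[of _ w])
      moreover have "S' \<subset> S"
      proof
        show "S' \<subseteq> S" by (auto simp: S'_def)
        have "k \<in> S" "k \<notin> S'" using kP wk by (simp_all add: S'_def P_def)
        then show "S' \<noteq> S" by blast
      qed
      ultimately show False
        using Smin[of S'] psubset_card_mono[OF finS, of S'] by auto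
    qed
    then show ?thesis by (auto simp: w_def intro!: exI[of _ t])
  qed
  obtain j where j: "j \<in> S" using SI by auto
  define S' where "S' = S - {j}"
  have finS': "finite S'" using finS by (simp add: S'_def)
  have ker: "v i = 0" if vrel: "(\<Sum>i\<in>S'. v i *\<^sub>R c i) = 0" and i: "i \<in> S'" for v i
  proof (rule ccontr)
    assume vi: "v i \<noteq> 0"
    \<comment> \<open>Extending by zero at \<open>j\<close> and fixing the sign gives a relation proportional to \<open>y\<close>, although
      \<open>y j\<close> is positive.\<close>
    define v' where "v' l = (if l = j then 0 else sgn (v i) * v l)" for l
    have "(\<Sum>l\<in>S. v' l *\<^sub>R c l) = (\<Sum>l\<in>S'. v' l *\<^sub>R c l)"
      using finS by (intro sum.mono_neutral_right) (auto simp: S'_def v'_def)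
    also have "\<dots> = (\<Sum>l\<in>S'. sgn (v i) *\<^sub>R v l *\<^sub>R c l)"
      by (rule sum.cong) (auto simp: S'_def v'_def)
    also have "\<dots> = sgn (v i) *\<^sub>R (\<Sum>l\<in>S'. v l *\<^sub>R c l)"
      by (rule scaleR_sum_right[symmetric])
    also have "\<dots> = 0" using vrel by simp
    finally have "(\<Sum>l\<in>S. v' l *\<^sub>R c l) = 0" .
    moreover have "v' i > 0" using i vi by (auto simp: v'_def S'_def sgn_if)
    ultimately obtain t where "\<forall>i\<in>S. y i = t * v' i"
      using proportional[of v'] i by (auto simp: S'_def)
    then have "y j = 0" using j by (simp add: v'_def)
    then show False using y0[OF j] by simp
  qed
  have inj: "inj_on c S'"
  proof (rule inj_onI, rule ccontr)
    fix a b assume ab: "a \<in> S'" "b \<in> S'" "c a = c b" "a \<noteq> b"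
    define v :: "'i \<Rightarrow> real" where "v l = (if l = a then 1 else if l = b then - 1 else 0)" for l
    have "(\<Sum>l\<in>S'. v l *\<^sub>R c l) = (\<Sum>l\<in>{a,b}. v l *\<^sub>R c l)"
      using finS' ab by (intro sum.mono_neutral_right) (auto simp: v_def)
    also have "\<dots> = 0" using ab by (simp add: v_def)
    finally have "v a = 0" using ker ab by blast
    then show False by (simp add: v_def)
  qed
  have ind: "independent (c ` S')"
  proof
    assume "dependent (c ` S')"
    then obtain g i where g: "(\<Sum>x\<in>c ` S'. g x *\<^sub>R x) = 0" and i: "i \<in> S'" "g (c i) \<noteq> 0"
      using dependent_finite[of "c ` S'"] finS' by blast
    have "(\<Sum>i\<in>S'. g (c i) *\<^sub>R c i) = 0" using g by (simp add: sum.reindex[OF inj])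
    from ker[OF this i(1)] i(2) show False by simp
  qed
  have yj: "y j > 0" using y0 j by simp
  \<comment> \<open>The coordinates of \<open>c j\<close> with respect to the independent family, read off from the relation.\<close>
  define z where "z x = - (y (the_inv_into S' c x) / y j)" for x
  have zc: "z (c i) = - (y i / y j)" if "i \<in> S'" for i
    using that inj by (simp add: z_def the_inv_into_f_f)
  have "(\<Sum>t\<in>c ` S'. z t *\<^sub>R t) = (\<Sum>i\<in>S'. (- (1 / y j)) *\<^sub>R y i *\<^sub>R c i)"
    by (simp add: sum.reindex[OF inj] zc)
  also have "\<dots> = (- (1 / y j)) *\<^sub>R (\<Sum>i\<in>S'. y i *\<^sub>R c i)"
    by (rule scaleR_sum_right[symmetric])
  also have "(\<Sum>i\<in>S'. y i *\<^sub>R c i) = - (y j *\<^sub>R c j)"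
    using yrel sum.remove[OF finS j, of "\<lambda>i. y i *\<^sub>R c i"]
    by (simp add: S'_def eq_neg_iff_add_eq_0 add.commute)
  finally have cj: "(\<Sum>t\<in>c ` S'. z t *\<^sub>R t) = c j" using yj by simp
  have jI: "j \<in> I" and S'I: "S' \<subseteq> I" using j SI by (auto simp: S'_def)
  obtain D :: real where D: "D \<in> \<int>" "0 < D" "D \<le> fact CARD('n) * W ^ CARD('n)"
    and Dz: "\<And>t. t \<in> c ` S' \<Longrightarrow> D * z t \<in> \<int> \<and> \<bar>D * z t\<bar> \<le> fact CARD('n) * W ^ CARD('n)"
    using bounded_denominator_of_coordinates[OF ind W1, of z] cZ cW jI S'I unfolding cj by blast
  define s where "s i = (if i \<in> S then D * y i / y j else 0)" for i
  have s_int: "s i \<in> \<int> \<and> s i \<le> fact CARD('n) * W ^ CARD('n)" if "i \<in> S" for i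
  proof (cases "i = j")
    case True
    then show ?thesis using D yj j by (simp add: s_def)
  next
    case False
    then have "i \<in> S'" using that by (simp add: S'_def)
    then have "- s i \<in> \<int>" "\<bar>- s i\<bar> \<le> fact CARD('n) * W ^ CARD('n)"
      using Dz[of "c i"] zc[of i] that by (auto simp: s_def)
    then show ?thesis by auto
  qed
  have s0: "s i \<ge> 0" for i using D y0 yj by (auto simp: s_def less_imp_le)
  define r where "r i = nat \<lfloor>s i\<rfloor>" for i
  have r: "real (r i) = s i" for i
    using s_int[of i] s0[of i] by (cases "i \<in> S") (auto simp: r_def s_def elim!: Ints_cases)
  show ?thesis
  proof
    have "real (r j) > 0" using r[of j] j yj D by (simp add: s_def)
    then show "\<exists>i\<in>I. r i > 0" using jI by auto
    show "r i = 0" if "i \<in> I" "u i = 0" for i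
    proof -
      have "i \<notin> S" using that SS0 by (auto simp: S0_def)
      then show ?thesis by (simp add: r_def s_def)
    qed
    show "real (r i) \<le> fact CARD('n) * W ^ CARD('n)" if "i \<in> I" for i
      using s_int[of i] D W1 unfolding r by (cases "i \<in> S") (auto simp: s_def)
    have "(\<Sum>i\<in>I. real (r i) *\<^sub>R c i) = (\<Sum>i\<in>S. (D / y j) *\<^sub>R y i *\<^sub>R c i)"
      unfolding r using fin SI by (intro sum.mono_neutral_cong_right) (auto simp: s_def)
    also have "\<dots> = (D / y j) *\<^sub>R (\<Sum>i\<in>S. y i *\<^sub>R c i)"
      by (rule scaleR_sum_right[symmetric])
    finally show "(\<Sum>i\<in>I. real (r i) *\<^sub>R c i) = 0" using yrel by simp
  qed
qed

text \<open>
  Subtract from \<open>u\<close> the largest multiple \<open>t r\<close> of a small integer relation \<open>r\<close> that leaves it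
  nonnegative. This removes a point from the support, so the process stops after at most as many
  steps as the support has points. Keeping only the integral part of each multiplier \<open>t\<close> costs at most
  the size of \<open>r\<close> per step.
\<close>

lemma round_down_nonneg_relation:
  fixes c :: "'i \<Rightarrow> real ^ 'n" and u :: "'i \<Rightarrow> real"
  assumes fin: "finite I" and W1: "W \<ge> 1"
    and cZ: "\<And>i. i \<in> I \<Longrightarrow> c i \<in> int_lattice"
    and cW: "\<And>i k. i \<in> I \<Longrightarrow> \<bar>c i $ k\<bar> \<le> W"
    and u0: "\<And>i. i \<in> I \<Longrightarrow> u i \<ge> 0" and rel: "(\<Sum>i\<in>I. u i *\<^sub>R c i) = 0"
  shows "\<exists>q :: 'i \<Rightarrow> nat. (\<Sum>i\<in>I. real (q i) *\<^sub>R c i) = 0 \<and>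
    (\<forall>i\<in>I. real (q i) \<le> u i \<and>
      u i \<le> real (q i) + real (card {i\<in>I. u i > 0}) * (fact CARD('n) * W ^ CARD('n)))"
  using u0 rel
proof (induction "card {i\<in>I. u i > 0}" arbitrary: u rule: less_induct)
  case less
  define \<Delta> :: real where "\<Delta> = fact CARD('n) * W ^ CARD('n)"
  have \<Delta>0: "\<Delta> \<ge> 0" using W1 by (simp add: \<Delta>_def)
  show ?case
  proof (cases "\<exists>i\<in>I. u i > 0")
    case False
    then have "u i = 0" if "i \<in> I" for i using less.prems(1)[OF that] that by force
    then show ?thesis using \<Delta>0 unfolding \<Delta>_def[symmetric] by (intro exI[of _ "\<lambda>_. 0"]) auto
  next
    case True
    then obtain i0 where i0: "i0 \<in> I" "u i0 > 0" by auto
    obtain r :: "'i \<Rightarrow> nat" where r: "\<exists>i\<in>I. r i > 0" "\<And>i. i \<in> I \<Longrightarrow> u i = 0 \<Longrightarrow> r i = 0"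
      "\<And>i. i \<in> I \<Longrightarrow> real (r i) \<le> \<Delta>" "(\<Sum>i\<in>I. real (r i) *\<^sub>R c i) = 0"
      using obtain_small_integer_relation[OF fin W1 cZ cW less.prems i0, folded \<Delta>_def] by blast
    define P where "P = {i\<in>I. r i > 0}"
    have P: "finite P" "P \<noteq> {}" using fin r by (auto simp: P_def)
    define k where "k = arg_min_on (\<lambda>i. u i / r i) P"
    have kP: "k \<in> P" unfolding k_def using P by (rule arg_min_if_finite)
    have kmin: "u k / r k \<le> u i / r i" if "i \<in> P" for i
      unfolding k_def using arg_min_least[OF P(1) P(2) that] .
    define t where "t = u k / r k"
    have t0: "t \<ge> 0" using kP less.prems(1)[of k] by (auto simp: t_def P_def)
    define w where "w i = u i - t * r i" for i
    have w0: "w i \<ge> 0" if "i \<in> I" for i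
    proof (cases "r i > 0")
      case True
      then show ?thesis using kmin[of i] that
        by (simp add: P_def w_def t_def[symmetric] pos_le_divide_eq)
    next
      case False
      then show ?thesis using less.prems(1)[OF that] by (simp add: w_def)
    qed
    have wk: "w k = 0" using kP by (simp add: w_def t_def P_def)
    have wrel: "(\<Sum>i\<in>I. w i *\<^sub>R c i) = 0"
      using less.prems(2) r(4) by (simp add: w_def scaleR_diff_left sum_subtractf
          flip: scaleR_scaleR scaleR_sum_right)
    have uk: "u k > 0" "k \<in> I" using kP r(2)[of k] less.prems(1)[of k] by (force simp: P_def)+
    have wu: "w i \<le> u i" for i using t0 by (simp add: w_def)
    have sub: "{i\<in>I. w i > 0} \<subset> {i\<in>I. u i > 0}"
    proof
      show "{i\<in>I. w i > 0} \<subseteq> {i\<in>I. u i > 0}" using wu by (auto intro: less_le_trans)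
      have "k \<in> {i\<in>I. u i > 0}" "k \<notin> {i\<in>I. w i > 0}" using uk wk by simp_all
      then show "{i\<in>I. w i > 0} \<noteq> {i\<in>I. u i > 0}" by blast
    qed
    then have card: "card {i\<in>I. w i > 0} < card {i\<in>I. u i > 0}"
      using fin by (intro psubset_card_mono) auto
    obtain q where q: "(\<Sum>i\<in>I. real (q i) *\<^sub>R c i) = 0"
      "\<forall>i\<in>I. real (q i) \<le> w i \<and> w i \<le> real (q i) + real (card {i\<in>I. w i > 0}) * \<Delta>"
      using less.hyps[OF card w0 wrel, folded \<Delta>_def] by blast
    define m where "m = nat \<lfloor>t\<rfloor>"
    have m: "real m \<le> t" "t \<le> real m + 1" using t0 by (auto simp: m_def)
    have "(\<Sum>i\<in>I. real (q i + m * r i) *\<^sub>R c i) = 0"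
      using q(1) r(4) by (simp add: scaleR_add_left sum.distrib
          flip: scaleR_scaleR scaleR_sum_right)
    moreover have "real (q i + m * r i) \<le> u i \<and>
      u i \<le> real (q i + m * r i) + real (card {i\<in>I. u i > 0}) * \<Delta>" if i: "i \<in> I" for i
    proof
      have "real m * r i \<le> t * r i" using m by (intro mult_right_mono) auto
      then show "real (q i + m * r i) \<le> u i" using q(2) i by (force simp: w_def)
      have "t * r i \<le> (real m + 1) * r i" using m by (intro mult_right_mono) auto
      then have "u i \<le> w i + real m * r i + \<Delta>"
        using r(3)[OF i] by (simp add: w_def algebra_simps)
      also have "\<dots> \<le> real (q i) + real (card {i\<in>I. w i > 0}) * \<Delta> + real m * r i + \<Delta>"
        using q(2) i by auto
      also have "\<dots> = real (q i + m * r i) + real (Suc (card {i\<in>I. w i > 0})) * \<Delta>"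
        by (simp add: algebra_simps)
      also have "\<dots> \<le> real (q i + m * r i) + real (card {i\<in>I. u i > 0}) * \<Delta>"
        using card \<Delta>0 by (intro add_left_mono mult_right_mono) auto
      finally show "u i \<le> real (q i + m * r i) + real (card {i\<in>I. u i > 0}) * \<Delta>" .
    qed
    ultimately show ?thesis
      unfolding \<Delta>_def[symmetric] by (intro exI[of _ "\<lambda>i. q i + m * r i"] conjI ballI) auto
  qed
qed


text \<open>
  The equation is a nonnegative relation between the vectors \<open>a - b\<close> and the vectors \<open>b - a\<close>, indexed
  by two disjoint copies of \<open>A\<close>. In an integer relation close to it from below, the part on the
  first copy can be traded for the part on the second: the former is nearly all of \<open>n\<close>, the
  latter is at most \<open>l\<close>.
\<close>

lemma exchange_sums_with_few_extra_terms:
  fixes A :: "(real ^ 'n) set" and n :: "real ^ 'n \<Rightarrow> nat" and l :: "real ^ 'n \<Rightarrow> real"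
  assumes fin: "finite A" and AZ: "A \<subseteq> int_lattice" and aA: "a \<in> A" and W1: "W \<ge> 1"
    and W: "\<And>b k. b \<in> A \<Longrightarrow> \<bar>a $ k - b $ k\<bar> \<le> W"
    and l0: "\<And>b. b \<in> A \<Longrightarrow> l b \<ge> 0"
    and eq: "(\<Sum>b\<in>A. real (n b) *\<^sub>R (a - b)) = (\<Sum>b\<in>A. l b *\<^sub>R (a - b))"
  obtains m :: "real ^ 'n \<Rightarrow> nat" where
    "(\<Sum>b\<in>A. real (m b) *\<^sub>R (a - b)) = (\<Sum>b\<in>A. l b *\<^sub>R (a - b))"
    "\<And>b. b \<in> A \<Longrightarrow> real (m b) \<le> l b + 2 * real (card A) * (fact CARD('n) * W ^ CARD('n))"
proof -
  define \<Delta> :: real where "\<Delta> = fact CARD('n) * W ^ CARD('n)"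
  have \<Delta>0: "\<Delta> \<ge> 0" using W1 by (simp add: \<Delta>_def)
  define c where "c = case_sum (\<lambda>b. a - b) (\<lambda>b. b - a)"
  define u where "u = case_sum (\<lambda>b. real (n b)) l"
  define I where "I = A <+> A"
  have finI: "finite I" using fin by (simp add: I_def)
  have cardI: "card {i\<in>I. u i > 0} \<le> 2 * card A"
    using card_mono[OF finI, of "{i\<in>I. u i > 0}"] card_Plus[OF fin fin] by (auto simp: I_def)
  have cZ: "c i \<in> int_lattice" if "i \<in> I" for i
  proof -
    have "b $ k \<in> \<int>" if "b \<in> A" for b k using that AZ by (auto simp: int_lattice_def)
    then show ?thesis using that aA by (auto simp: I_def c_def int_lattice_def intro!: Ints_diff)
  qed
  have cW: "\<bar>c i $ k\<bar> \<le> W" if "i \<in> I" for i k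
    using that W by (auto simp: I_def c_def abs_minus_commute)
  have u0: "u i \<ge> 0" if "i \<in> I" for i using that l0 by (auto simp: I_def u_def)
  have neg: "(\<Sum>b\<in>A. g b *\<^sub>R (b - a)) = - (\<Sum>b\<in>A. g b *\<^sub>R (a - b))" for g
    by (simp add: sum_negf[symmetric] scaleR_minus_right[symmetric] del: scaleR_minus_right)
  have "(\<Sum>i\<in>I. u i *\<^sub>R c i) = 0"
    unfolding I_def using fin by (simp add: sum.Plus u_def c_def neg eq)
  from round_down_nonneg_relation[OF finI W1 cZ cW u0 this]
  obtain q :: "_ \<Rightarrow> nat" where q0: "(\<Sum>i\<in>I. real (q i) *\<^sub>R c i) = 0"
    and q: "\<And>i. i \<in> I \<Longrightarrow> real (q i) \<le> u i \<and> u i \<le> real (q i) + real (card {i\<in>I. u i > 0}) * \<Delta>"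
    unfolding \<Delta>_def by blast
  have qn: "q (Inl b) \<le> n b" and ql: "real (q (Inr b)) \<le> l b"
    and nq: "real (n b) \<le> real (q (Inl b)) + 2 * real (card A) * \<Delta>" if "b \<in> A" for b
  proof -
    have "Inl b \<in> I" "Inr b \<in> I" using that by (auto simp: I_def)
    note q[OF this(1)] q[OF this(2)]
    moreover have "real (card {i\<in>I. u i > 0}) * \<Delta> \<le> 2 * real (card A) * \<Delta>"
      using cardI \<Delta>0 by (intro mult_right_mono) auto
    ultimately show "q (Inl b) \<le> n b" "real (q (Inr b)) \<le> l b"
      "real (n b) \<le> real (q (Inl b)) + 2 * real (card A) * \<Delta>"
      by (auto simp: u_def)
  qed
  define m where "m b = n b - q (Inl b) + q (Inr b)" for b
  have mr: "real (m b) = real (n b) - real (q (Inl b)) + real (q (Inr b))" if "b \<in> A" for b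
    using qn[OF that] by (simp add: m_def of_nat_diff)
  show ?thesis
  proof
    have "(\<Sum>b\<in>A. real (q (Inl b)) *\<^sub>R (a - b)) = (\<Sum>b\<in>A. real (q (Inr b)) *\<^sub>R (a - b))"
      using q0 fin by (simp add: I_def sum.Plus c_def neg)
    then show "(\<Sum>b\<in>A. real (m b) *\<^sub>R (a - b)) = (\<Sum>b\<in>A. l b *\<^sub>R (a - b))"
      using eq by (simp add: mr scaleR_add_left scaleR_left_diff_distrib sum.distrib sum_subtractf)
    show "real (m b) \<le> l b + 2 * real (card A) * (fact CARD('n) * W ^ CARD('n))" if "b \<in> A" for b
      using mr[OF that] nq[OF that] ql[OF that] by (simp add: \<Delta>_def)
  qed
qed

section \<open>Sumsets and extremal points\<close>

lemma mem_sumset_iff_multiplicities: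
  fixes A :: "(real ^ 'n) set"
  assumes fin: "finite A"
  shows "y \<in> sumset N A \<longleftrightarrow> (\<exists>m :: real ^ 'n \<Rightarrow> nat. sum m A = N \<and> y = (\<Sum>b\<in>A. real (m b) *\<^sub>R b))"
proof
  assume "y \<in> sumset N A"
  then obtain a where a: "\<forall>i<N. a i \<in> A" "y = (\<Sum>i<N. a i)" by (auto simp: sumset_def)
  define m where "m b = card {i\<in>{..<N}. a i = b}" for b
  have sub: "a ` {..<N} \<subseteq> A" using a by auto
  have "sum m A = N"
    using sum.group[OF _ fin sub, of "\<lambda>_. 1::nat"] by (simp add: m_def)
  moreover have "(\<Sum>b\<in>A. real (m b) *\<^sub>R b) = (\<Sum>b\<in>A. \<Sum>i\<in>{i\<in>{..<N}. a i = b}. a i)"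
    by (intro sum.cong refl) (simp add: m_def sum_constant_scaleR del: sum_constant)
  then have "(\<Sum>b\<in>A. real (m b) *\<^sub>R b) = y"
    using sum.group[OF _ fin sub, of a] a by simp
  ultimately show "\<exists>m :: real ^ 'n \<Rightarrow> nat. sum m A = N \<and> y = (\<Sum>b\<in>A. real (m b) *\<^sub>R b)" by blast
next
  assume "\<exists>m :: real ^ 'n \<Rightarrow> nat. sum m A = N \<and> y = (\<Sum>b\<in>A. real (m b) *\<^sub>R b)"
  then obtain m :: "real ^ 'n \<Rightarrow> nat" where "sum m A = N" "y = (\<Sum>b\<in>A. real (m b) *\<^sub>R b)" by blast
  then show "y \<in> sumset N A"
  proof (induction N arbitrary: m y)
    case 0
    then have "y = 0" using fin by simp
    then show ?case by (simp add: sumset_def)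
  next
    case (Suc N)
    obtain b where b: "b \<in> A" "m b > 0"
      using Suc.prems(1) by (metis sum.neutral nat.distinct(1) gr0I)
    define m' where "m' = m(b := m b - 1)"
    have mm: "m x = m' x + (if x = b then 1 else 0)" for x using b by (simp add: m'_def)
    have "sum m A = sum m' A + 1" using b fin by (simp add: mm sum.distrib)
    then have s: "sum m' A = N" using Suc.prems by simp
    have "(\<Sum>x\<in>A. real (m x) *\<^sub>R x) = (\<Sum>x\<in>A. real (m' x) *\<^sub>R x + (if x = b then b else 0))"
      by (intro sum.cong refl) (auto simp: mm scaleR_add_left)
    then have y: "y = (\<Sum>x\<in>A. real (m' x) *\<^sub>R x) + b"
      using Suc.prems(2) b fin by (simp add: sum.distrib)
    obtain a where a: "\<forall>i<N. a i \<in> A" "(\<Sum>x\<in>A. real (m' x) *\<^sub>R x) = (\<Sum>i<N. a i)"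
      using Suc.IH[OF s refl] by (auto simp: sumset_def)
    have "(\<Sum>i<Suc N. (a(N := b)) i) = y" using a y by simp
    moreover have "\<forall>i<Suc N. (a(N := b)) i \<in> A" using a b by (simp add: less_Suc_eq)
    ultimately show ?case unfolding sumset_def by blast
  qed
qed

text \<open>
  Faces of a polytope are exposed, which gives a supporting functional that is maximal only at \<open>a\<close>. Its
  component orthogonal to the span of \<open>A - A\<close> is constant on the hull and can be dropped; what is
  left is nonzero because it separates \<open>a\<close> from \<open>b\<close>.
\<close>

lemma extreme_point_in_extremal_points:
  fixes A :: "(real ^ 'n) set"
  assumes fin: "finite A" and ext: "a extreme_point_of (convex hull A)" and b: "b \<in> A" "b \<noteq> a"
  shows "a \<in> extremal_points A"
proof -
  let ?H = "convex hull A"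
  have aA: "a \<in> A" using ext by (rule extreme_point_of_convex_hull)
  have "{a} exposed_face_of ?H"
    using ext exposed_face_of_polyhedron[OF polyhedron_convex_hull[OF fin]] face_of_singleton by blast
  then obtain w \<beta> where w: "?H \<subseteq> {x. w \<bullet> x \<le> \<beta>}" "{a} = ?H \<inter> {x. w \<bullet> x = \<beta>}"
    unfolding exposed_face_of_def by blast
  obtain y z where yz: "y \<in> span (diffset A A)" "\<And>t. t \<in> span (diffset A A) \<Longrightarrow> orthogonal z t"
      "w = y + z"
    using orthogonal_subspace_decomp_exists[of "diffset A A" w] by blast
  have "A \<subseteq> {x. z \<bullet> x = z \<bullet> a}"
  proof
    fix x assume "x \<in> A"
    then have "x - a \<in> span (diffset A A)" using aA by (intro span_base) (auto simp: diffset_def)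
    then show "x \<in> {x. z \<bullet> x = z \<bullet> a}" using yz(2)[of "x - a"] by (simp add: orthogonal_def inner_diff_right)
  qed
  then have z: "?H \<subseteq> {x. z \<bullet> x = z \<bullet> a}" by (rule hull_minimal) (rule convex_hyperplane)
  have lt: "y \<bullet> x < y \<bullet> a" if x: "x \<in> ?H" "x \<noteq> a" for x
  proof -
    have "w \<bullet> x \<le> \<beta>" "w \<bullet> x \<noteq> \<beta>" "w \<bullet> a = \<beta>" using w x by blast+
    moreover have "z \<bullet> x = z \<bullet> a" using z x by blast
    ultimately show ?thesis by (simp add: yz(3) inner_add_left)
  qed
  have "y \<noteq> 0" using lt[of b] b by (auto simp: hull_inc)
  then have "- y \<in> span (diffset A A) - {0}" using yz(1) by (simp add: span_neg)
  moreover have "\<forall>x \<in> ?H - {a}. (- y) \<bullet> x > (- y) \<bullet> a" using lt by auto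
  moreover have "a \<in> ?H" using aA by (rule hull_inc)
  ultimately show ?thesis unfolding extremal_points_def by blast
qed

lemma group_closure_sum_mem:
  fixes f :: "'i \<Rightarrow> 'a::ab_group_add"
  assumes "\<And>i. i \<in> I \<Longrightarrow> f i \<in> group_closure S"
  shows "sum f I \<in> group_closure S"
  using assms by (induction I rule: infinite_finite_induct) (auto intro: group_closure_add)

lemma group_closure_scaleR_nat:
  fixes s :: "real ^ 'n"
  assumes "s \<in> group_closure S"
  shows "real k *\<^sub>R s \<in> group_closure S"
  using assms by (induction k) (auto simp: scaleR_add_left intro: group_closure_add)

lemma group_closure_diffset_subset:
  fixes A :: "(real ^ 'n) set"
  assumes "l \<in> group_closure (diffset A A)"
  shows "l \<in> group_closure (diffset {a} A)"
  using assms
proof induction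
  case (base s)
  have "b1 - b2 \<in> group_closure (diffset {a} A)" if "b1 \<in> A" "b2 \<in> A" for b1 b2
  proof -
    have "(a - b2) - (a - b1) \<in> group_closure (diffset {a} A)"
      using that by (intro group_closure.diff group_closure.base) (auto simp: diffset_def)
    then show ?thesis by simp
  qed
  then show ?case using base by (auto simp: diffset_def)
qed (rule group_closure.diff)

lemma diffset_singleton: "diffset {a} A = (\<lambda>b. a - b) ` A"
  by (auto simp: diffset_def)

lemma all_sums_diffset_multiplicities:
  fixes A :: "(real ^ 'n) set"
  assumes fin: "finite A" and e: "e \<in> all_sums (diffset {a} A)"
  obtains n :: "real ^ 'n \<Rightarrow> nat" where "e = (\<Sum>b\<in>A. real (n b) *\<^sub>R (a - b))"
proof -
  obtain M where "e \<in> sumset M ((\<lambda>b. a - b) ` A)"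
    using e by (auto simp: all_sums_def diffset_singleton)
  then obtain m :: "real ^ 'n \<Rightarrow> nat" where "e = (\<Sum>x\<in>(\<lambda>b. a - b) ` A. real (m x) *\<^sub>R x)"
    using mem_sumset_iff_multiplicities[of "(\<lambda>b. a - b) ` A"] fin by auto
  also have "\<dots> = (\<Sum>b\<in>A. real (m (a - b)) *\<^sub>R (a - b))"
    by (subst sum.reindex) (auto simp: inj_on_def)
  finally show ?thesis by (rule that)
qed

section \<open>The width and the size of \<open>N\<close>\<close>

lemma component_diff_le_width:
  fixes A :: "(real ^ 'n) set"
  assumes "finite A" "a \<in> A" "b \<in> A"
  shows "\<bar>a $ k - b $ k\<bar> \<le> width A"
proof -
  have "infnorm (a - b) \<le> width A"
    unfolding width_def using assms by (intro Max_ge finite_image_set2) auto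
  then show ?thesis using component_le_infnorm_cart[of "a - b" k] by simp
qed

lemma width_ge_1:
  fixes A :: "(real ^ 'n) set"
  assumes "finite A" "A \<subseteq> int_lattice" "a \<in> A" "b \<in> A" "a \<noteq> b"
  shows "1 \<le> width A"
proof -
  obtain k where k: "a $ k \<noteq> b $ k" using \<open>a \<noteq> b\<close> by (auto simp: vec_eq_iff)
  have "a $ k \<in> \<int>" "b $ k \<in> \<int>" using assms unfolding int_lattice_def by blast+
  then have "a $ k - b $ k \<in> \<int>" by (rule Ints_diff)
  then have "1 \<le> \<bar>a $ k - b $ k\<bar>" using k by (intro Ints_nonzero_abs_ge1) auto
  also have "\<dots> \<le> width A" using assms by (intro component_diff_le_width)
  finally show ?thesis .
qed

text \<open>
  With \<open>X = d k w\<close> one has \<open>2 k ^ 3 \<le> k ^ 4 \<le> X ^ 4\<close> and \<open>d! w ^ d \<le> X ^ d\<close>, and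
  \<open>4 + d \<le> 13 d ^ 6\<close>.
\<close>

lemma polynomial_bound_le_threshold:
  fixes d k :: nat and w :: real
  assumes d: "d \<ge> 1" and k: "k \<ge> 2" and w: "w \<ge> 1"
  shows "2 * real k ^ 3 * (fact d * w ^ d) \<le> (real d * real k * w) ^ (13 * d ^ 6)"
proof -
  define X where "X = real d * real k * w"
  have kX: "real k \<le> X"
    using d w mult_mono[of 1 "real d * w" "real k" "real k"] mult_mono[of 1 "real d" 1 w]
    by (simp add: X_def algebra_simps)
  have dw: "real d * w \<le> X"
    using k w d mult_left_mono[of 1 "real k" "real d * w"] by (simp add: X_def algebra_simps)
  have X1: "1 \<le> X" using kX k by simp
  have "2 * real k ^ 3 \<le> real k * real k ^ 3" using k by (intro mult_right_mono) auto
  also have "\<dots> \<le> X * X ^ 3" using kX X1 by (intro mult_mono power_mono) auto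
  finally have 1: "2 * real k ^ 3 \<le> X ^ 4" by (simp add: numeral_eq_Suc)
  have "fact d * w ^ d \<le> real d ^ d * w ^ d"
    using fact_le_power[of d, where 'a = real] w by (intro mult_right_mono) auto
  also have "\<dots> = (real d * w) ^ d" by (simp add: power_mult_distrib)
  also have "\<dots> \<le> X ^ d" using dw w by (intro power_mono) auto
  finally have 2: "fact d * w ^ d \<le> X ^ d" .
  have "2 * real k ^ 3 * (fact d * w ^ d) \<le> X ^ 4 * X ^ d"
    using 1 2 X1 w by (intro mult_mono) auto
  also have "\<dots> = X ^ (4 + d)" by (simp add: power_add)
  also have "\<dots> \<le> X ^ (13 * d ^ 6)"
  proof (rule power_increasing[OF _ X1])
    have "d ^ 1 \<le> d ^ 6" using d by (intro power_increasing) auto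
    then show "4 + d \<le> 13 * d ^ 6" using d by simp
  qed
  finally show ?thesis by (simp add: X_def)
qed


section \<open>The structure theorem\<close>

lemma sumset_subset_structure:
  fixes A :: "(real ^ 'n) set"
  assumes a0: "a0 \<in> A" and N: "N \<ge> 1" and x: "x \<in> sumset N A"
  shows "x \<in> (\<lambda>x. real N *\<^sub>R x) ` (convex hull A)"
    and "x - real N *\<^sub>R a0 \<in> group_closure (diffset A A)"
    and "real N *\<^sub>R a - x \<in> all_sums (diffset {a} A)"
proof -
  obtain f where f: "\<And>i. i < N \<Longrightarrow> f i \<in> A" and x: "x = (\<Sum>i<N. f i)"
    using x by (auto simp: sumset_def)
  have N_sum: "real N *\<^sub>R b = (\<Sum>i<N. b)" for b :: "real ^ 'n"
    by (simp add: sum_constant_scaleR del: sum_constant)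
  have "(\<Sum>i<N. (1 / real N) *\<^sub>R f i) \<in> convex hull A"
    using f N by (intro convex_sum) (auto simp: hull_inc)
  moreover have "x = real N *\<^sub>R (\<Sum>i<N. (1 / real N) *\<^sub>R f i)"
    using N by (simp add: x scaleR_sum_right)
  ultimately show "x \<in> (\<lambda>x. real N *\<^sub>R x) ` (convex hull A)" by blast
  have "x - real N *\<^sub>R a0 = (\<Sum>i<N. f i - a0)" by (simp add: x N_sum sum_subtractf del: sum_constant)
  also have "\<dots> \<in> group_closure (diffset A A)"
    using f a0 by (intro group_closure_sum_mem group_closure.base) (auto simp: diffset_def)
  finally show "x - real N *\<^sub>R a0 \<in> group_closure (diffset A A)" .
  have "real N *\<^sub>R a - x = (\<Sum>i<N. a - f i)" by (simp add: x N_sum sum_subtractf del: sum_constant)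
  moreover have "\<forall>i<N. a - f i \<in> diffset {a} A" using f by (auto simp: diffset_def)
  ultimately have "real N *\<^sub>R a - x \<in> sumset N (diffset {a} A)" unfolding sumset_def by blast
  then show "real N *\<^sub>R a - x \<in> all_sums (diffset {a} A)" using N by (auto simp: all_sums_def)
qed

lemma cone_lattice_member_of_structure:
  fixes A :: "(real ^ 'n) set"
  assumes fin: "finite A" and a0: "a0 \<in> A"
    and h: "h \<in> convex hull A"
    and l: "real N *\<^sub>R h - real N *\<^sub>R a0 \<in> group_closure (diffset A A)"
  shows "real N *\<^sub>R a - real N *\<^sub>R h \<in> gen_cone (diffset {a} A) \<inter> group_closure (diffset {a} A)"
proof
  obtain u where u: "\<forall>b\<in>A. 0 \<le> u b" "sum u A = 1" "(\<Sum>b\<in>A. u b *\<^sub>R b) = h"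
    using h unfolding convex_hull_finite[OF fin] by blast
  have "real N *\<^sub>R a - real N *\<^sub>R h = real N *\<^sub>R (\<Sum>b\<in>A. u b *\<^sub>R (a - b))"
    using u by (simp add: scaleR_diff_right sum_subtractf flip: scaleR_sum_left)
  also have "\<dots> = (\<Sum>b\<in>A. (real N * u b) *\<^sub>R (a - b))"
    by (simp add: scaleR_sum_right)
  also have "\<dots> = (\<Sum>s\<in>diffset {a} A. (real N * u (a - s)) *\<^sub>R s)"
    unfolding diffset_singleton by (subst sum.reindex) (auto simp: inj_on_def)
  finally show "real N *\<^sub>R a - real N *\<^sub>R h \<in> gen_cone (diffset {a} A)"
    unfolding gen_cone_def using u(1)
    by (auto simp: diffset_singleton intro!: exI[of _ "\<lambda>s. real N * u (a - s)"])
  have "a - a0 \<in> group_closure (diffset {a} A)"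
    using a0 by (intro group_closure.base) (auto simp: diffset_def)
  then have "real N *\<^sub>R (a - a0) - (real N *\<^sub>R h - real N *\<^sub>R a0) \<in> group_closure (diffset {a} A)"
    by (rule group_closure.diff[OF group_closure_scaleR_nat group_closure_diffset_subset[OF l]])
  then show "real N *\<^sub>R a - real N *\<^sub>R h \<in> group_closure (diffset {a} A)"
    by (simp add: scaleR_diff_right)
qed

text \<open>
  A polytope is the hull of its extreme points, and one of the weights of a convex combination is
  at least their average. The weights are extended by zero to all of \<open>A\<close>.
\<close>

lemma extreme_point_of_large_weight:
  fixes A :: "(real ^ 'n) set"
  assumes fin: "finite A" and h: "h \<in> convex hull A"
  obtains a u where "a extreme_point_of (convex hull A)" "\<forall>b\<in>A. u b \<ge> 0" "sum u A = 1"
    "(\<Sum>b\<in>A. u b *\<^sub>R b) = h" "u a \<ge> 1 / real (card A)"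
proof -
  define E where "E = {x. x extreme_point_of (convex hull A)}"
  have EA: "E \<subseteq> A" by (auto simp: E_def intro: extreme_point_of_convex_hull)
  then have finE: "finite E" using fin finite_subset by blast
  have "h \<in> convex hull E"
    using Krein_Milman_Minkowski[of "convex hull A"] h fin
    by (simp add: E_def finite_imp_compact_convex_hull)
  then obtain v where v: "\<forall>b\<in>E. 0 \<le> v b" "sum v E = 1" "(\<Sum>b\<in>E. v b *\<^sub>R b) = h"
    unfolding convex_hull_finite[OF finE] by blast
  define u where "u b = (if b \<in> E then v b else 0)" for b
  have "E \<noteq> {}" using v(2) by auto
  have "\<exists>a\<in>E. v a \<ge> 1 / real (card E)"
  proof (rule ccontr)
    assume "\<not> ?thesis"
    then have "sum v E < (\<Sum>a\<in>E. 1 / real (card E))"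
      using finE \<open>E \<noteq> {}\<close> by (intro sum_strict_mono) auto
    then show False using v(2) finE \<open>E \<noteq> {}\<close> by simp
  qed
  then obtain a where a: "a \<in> E" "v a \<ge> 1 / real (card E)" by blast
  show ?thesis
  proof
    show "a extreme_point_of (convex hull A)" using a by (simp add: E_def)
    show "\<forall>b\<in>A. u b \<ge> 0" using v by (simp add: u_def)
    show "sum u A = 1"
      using v(2) sum.mono_neutral_cong_left[OF fin EA, of u v] by (simp add: u_def)
    have "(\<Sum>b\<in>E. v b *\<^sub>R b) = (\<Sum>b\<in>A. u b *\<^sub>R b)"
      by (rule sum.mono_neutral_cong_left[OF fin EA]) (auto simp: u_def)
    then show "(\<Sum>b\<in>A. u b *\<^sub>R b) = h" using v(3) by simp
    have "card E > 0" "card E \<le> card A"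
      using finE \<open>E \<noteq> {}\<close> card_mono[OF fin EA] by (auto simp: card_gt_0_iff)
    then have "1 / real (card A) \<le> 1 / real (card E)" by (intro divide_left_mono) auto
    then show "u a \<ge> 1 / real (card A)" using a by (simp add: u_def)
  qed
qed

text \<open>
  The base point \<open>a\<close> is an extreme point of weight at least \<open>1 / |A|\<close> in \<open>h\<close>. Passing to the short representation of
  \<open>N a - N h\<close> adds at most \<open>|A| K\<close> terms to the total weight of the points other than \<open>a\<close>, and that
  total falls short of \<open>N\<close> by at least \<open>N / |A|\<close>.
\<close>

lemma structure_subset_sumset:
  fixes A :: "(real ^ 'n) set"
  assumes fin: "finite A" and AZ: "A \<subseteq> int_lattice" and two: "card A \<ge> 2"
    and N: "2 * real (card A) ^ 3 * (fact CARD('n) * width A ^ CARD('n)) \<le> real N"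
    and h: "h \<in> convex hull A"
    and sums: "\<And>a. a \<in> extremal_points A \<Longrightarrow> real N *\<^sub>R a - real N *\<^sub>R h \<in> all_sums (diffset {a} A)"
  shows "real N *\<^sub>R h \<in> sumset N A"
proof -
  define K where "K = 2 * real (card A) * (fact CARD('n) * width A ^ CARD('n))"
  obtain a u where a: "a extreme_point_of (convex hull A)" and u0: "\<forall>b\<in>A. u b \<ge> 0"
    and u1: "sum u A = 1" and uh: "(\<Sum>b\<in>A. u b *\<^sub>R b) = h" and ua: "u a \<ge> 1 / real (card A)"
    using extreme_point_of_large_weight[OF fin h] by blast
  have aA: "a \<in> A" using a by (rule extreme_point_of_convex_hull)
  have "\<not> A \<subseteq> {a}"
    using two card_mono[of "{a}" A] by auto
  then obtain b where b: "b \<in> A" "b \<noteq> a" by blast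
  have W1: "1 \<le> width A" using width_ge_1[OF fin AZ b(1) aA b(2)] .
  have K0: "K \<ge> 0" using W1 by (simp add: K_def)
  have "a \<in> extremal_points A" using extreme_point_in_extremal_points[OF fin a b] .
  from all_sums_diffset_multiplicities[OF fin sums[OF this]]
  obtain n :: "real ^ 'n \<Rightarrow> nat" where
    n: "real N *\<^sub>R a - real N *\<^sub>R h = (\<Sum>b\<in>A. real (n b) *\<^sub>R (a - b))" .
  have sum_a: "(\<Sum>b\<in>A. g b *\<^sub>R (a - b)) = sum g A *\<^sub>R a - (\<Sum>b\<in>A. g b *\<^sub>R b)" for g
    by (simp add: scaleR_diff_right sum_subtractf scaleR_sum_left)
  have uN: "real N *\<^sub>R a - real N *\<^sub>R h = (\<Sum>b\<in>A. (real N * u b) *\<^sub>R (a - b))"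
  proof -
    have "real N *\<^sub>R a - real N *\<^sub>R h = real N *\<^sub>R (\<Sum>b\<in>A. u b *\<^sub>R (a - b))"
      unfolding sum_a u1 uh by (simp add: scaleR_diff_right)
    then show ?thesis by (simp add: scaleR_sum_right)
  qed
  obtain m :: "real ^ 'n \<Rightarrow> nat" where
    m: "(\<Sum>b\<in>A. real (m b) *\<^sub>R (a - b)) = real N *\<^sub>R a - real N *\<^sub>R h"
    and mle: "\<And>b. b \<in> A \<Longrightarrow> real (m b) \<le> real N * u b + K"
    using exchange_sums_with_few_extra_terms[OF fin AZ aA W1, of "\<lambda>b. real N * u b" n]
      component_diff_le_width[OF fin aA] u0 n uN unfolding K_def by auto
  have rest: "sum g A = g a + sum g (A - {a})" for g :: "_ \<Rightarrow> real"
    by (rule sum.remove[OF fin aA])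
  have "real (card A) * K \<le> real N * (1 / real (card A))"
    using N two by (simp add: K_def field_simps power3_eq_cube)
  also have "\<dots> \<le> real N * u a" using ua by (intro mult_left_mono) auto
  finally have room: "real (card A) * K \<le> real N * u a" .
  have "real (\<Sum>b\<in>A - {a}. m b) \<le> (\<Sum>b\<in>A - {a}. real N * u b + K)"
    unfolding of_nat_sum by (rule sum_mono) (use mle in auto)
  also have "\<dots> = real N * (1 - u a) + real (card (A - {a})) * K"
    using rest[of u] u1 by (simp add: sum.distrib flip: sum_distrib_left)
  also have "\<dots> \<le> real N * (1 - u a) + real (card A) * K"
    using K0 card_mono[OF fin, of "A - {a}"] by (intro add_left_mono mult_right_mono) auto
  also have "\<dots> \<le> real N" using room by (simp add: algebra_simps)
  finally have few: "(\<Sum>b\<in>A - {a}. m b) \<le> N" by (simp only: of_nat_le_iff)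
  \<comment> \<open>The multiplicity of \<open>a\<close> is free, since its term is zero; it pads the sum to \<open>N\<close> terms.\<close>
  define m' where "m' = m(a := N - (\<Sum>b\<in>A - {a}. m b))"
  have "sum m' (A - {a}) = sum m (A - {a})" by (intro sum.cong) (auto simp: m'_def)
  then have m'N: "sum m' A = N"
    using few sum.remove[OF fin aA, of m'] by (simp add: m'_def)
  have "(\<Sum>b\<in>A. real (m' b) *\<^sub>R (a - b)) = (\<Sum>b\<in>A. real (m b) *\<^sub>R (a - b))"
    by (intro sum.cong) (auto simp: m'_def)
  then have "real N *\<^sub>R h = (\<Sum>b\<in>A. real (m' b) *\<^sub>R b)"
    using m m'N sum_a[of "\<lambda>b. real (m' b)"] by (simp flip: of_nat_sum)
  then show ?thesis using m'N mem_sumset_iff_multiplicities[OF fin] by blast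
qed

theorem theorem1p3:
  fixes A :: "(real ^ 'n) set" and a0 :: "real ^ 'n" and N :: nat
  assumes "finite A" and "A \<noteq> {}" and "A \<subseteq> int_lattice" and "a0 \<in> A"
    and "N \<ge> 1"
    and "real N \<ge> (real CARD('n) * real (card A) * width A) ^ (13 * CARD('n) ^ 6)"
  shows "sumset N A =
      ((\<lambda>x. real N *\<^sub>R x) ` (convex hull A)
         \<inter> {real N *\<^sub>R a0 + l | l. l \<in> group_closure (diffset A A)})
      - (\<Union>a \<in> extremal_points A.
           {real N *\<^sub>R a - e | e. e \<in> exceptional (diffset {a} A)})"
    (is "_ = ?H \<inter> ?L - ?E")
proof (intro equalityI subsetI)
  fix x assume x: "x \<in> sumset N A"
  note S = sumset_subset_structure[OF assms(4,5) x]
  have "x = real N *\<^sub>R a0 + (x - real N *\<^sub>R a0)" by simp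
  then have "x \<in> ?L" using S(2) by blast
  moreover have "x \<notin> ?E"
  proof
    assume "x \<in> ?E"
    then obtain a e where e: "x = real N *\<^sub>R a - e" "e \<in> exceptional (diffset {a} A)" by blast
    then have "e = real N *\<^sub>R a - x" by simp
    then show False using e(2) S(3)[of a] by (simp add: exceptional_def)
  qed
  ultimately show "x \<in> ?H \<inter> ?L - ?E" using S(1) by blast
next
  fix x assume x: "x \<in> ?H \<inter> ?L - ?E"
  then obtain h l where h: "h \<in> convex hull A" "x = real N *\<^sub>R h"
    and l: "x = real N *\<^sub>R a0 + l" "l \<in> group_closure (diffset A A)" by blast
  show "x \<in> sumset N A"
  proof (cases "card A \<ge> 2")
    \<comment> \<open>For a single point the width is zero and there are no extremal points to subtract.\<close>
    case False
    then have "card A = 1" using assms(1,2) card_gt_0_iff[of A] by linarith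
    then have A: "A = {a0}" using assms(4) by (auto simp: card_1_singleton_iff)
    then have "x = (\<Sum>b\<in>A. real N *\<^sub>R b)" using h by simp
    then show ?thesis
      using mem_sumset_iff_multiplicities[OF assms(1), of x N] A by (auto intro!: exI[of _ "\<lambda>_. N"])
  next
    case True
    then have "\<not> A \<subseteq> {a0}" using card_mono[of "{a0}" A] by auto
    then obtain b where b: "b \<in> A" "b \<noteq> a0" by blast
    have W1: "1 \<le> width A" using width_ge_1[OF assms(1,3) b(1) assms(4) b(2)] .
    have big: "2 * real (card A) ^ 3 * (fact CARD('n) * width A ^ CARD('n)) \<le> real N"
      using polynomial_bound_le_threshold[OF _ True W1, of "CARD('n)"] assms(6) by simp
    have "real N *\<^sub>R a - real N *\<^sub>R h \<in> all_sums (diffset {a} A)" if a: "a \<in> extremal_points A" for a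
    proof (rule ccontr)
      assume not_sum: "\<not> ?thesis"
      have "real N *\<^sub>R h - real N *\<^sub>R a0 \<in> group_closure (diffset A A)"
        using l by (simp flip: h(2))
      with not_sum have "real N *\<^sub>R a - real N *\<^sub>R h \<in> exceptional (diffset {a} A)"
        using cone_lattice_member_of_structure[OF assms(1,4) h(1), of N a]
        by (simp add: exceptional_def)
      moreover have "x = real N *\<^sub>R a - (real N *\<^sub>R a - real N *\<^sub>R h)" using h by simp
      ultimately show False using x a by blast
    qed
    then show ?thesis
      using structure_subset_sumset[OF assms(1,3) True big h(1)] h(2) by simp
  qed
qed

end
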